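(* Let $\mathbb{D}_Q\subseteq\mathbb{M}^{d_1}$ and $\mathbb{D}_P\subseteq\mathbb{M}^{d_2}$ be nc operator balls and let $\mathfrak{V}\subseteq\mathbb{D}_Q$ be a subvariety. For any nc map $F\colon\mathfrak{V}\to\overline{\mathbb{D}_P}$, the following dichotomy holds: (1) If $F(X_0)\in\mathbb{D}_P$ for some $X_0\in\mathfrak{V}$, then $F(\mathfrak{V})\subset\mathbb{D}_P$. (2) If $F(X_0)\in\partial\mathbb{D}_P$ for some $X_0\in\mathfrak{V}$, then $F(\mathfrak{V})\subset\partial\mathbb{D}_P$.
   Context: $M_n$ is the algebra of complex $n\times n$ matrices with operator norm, $M_n^d$ the set of $d$-tuples, $\mathbb{M}^d=\bigsqcup_{n\ge1}M_n^d$, and $\Omega(n)=\Omega\cap M_n^d$ for $\Omega\subseteq\mathbb{M}^d$. Direct sums are coordinatewise, and $S\cdot X=(S^{-1}X_1S,\dots,S^{-1}X_dS)$ for $S\in GL_n(\mathbb{C})$. A nc set is a subset of $\mathbb{M}^d$ closed under direct sums. A nc function (nc map) $F\colon\Omega\to\mathbb{M}^e$ on a nc set is a map with $F(\Omega(n))\subseteq M_n^e$, $F(X\oplus Y)=F(X)\oplus F(Y)$, and $F(S\cdot X)=S\cdot F(X)$ whenever $X,S\cdot X\in\Omega(n)$, $S\in GL_n(\mathbb{C})$. Let $\mathcal{R},\mathcal{S}$ be Hilbert spaces and $Q_1,\dots,Q_d\in\mathcal{L}(\mathcal{R},\mathcal{S})$ linearly independent. Put $Q(X)=\sum_{j=1}^dQ_j\otimes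 X_j\in\mathcal{L}(\mathcal{R}^n,\mathcal{S}^n)$ for $X\in M_n^d$. The nc operator ball of $Q$ is $\mathbb{D}_Q=\{X\in\mathbb{M}^d:\|Q(X)\|<1\}$, with levelwise closure $\overline{\mathbb{D}_Q}=\{X:\|Q(X)\|\le1\}$ and boundary $\partial\mathbb{D}_Q=\{X:\|Q(X)\|=1\}$; similarly for $\mathbb{D}_P$. $H^\infty(\mathbb{D}_Q)$ is the algebra of nc functions $F\colon\mathbb{D}_Q\to\mathbb{M}^1$ with $\sup_X\|F(X)\|<\infty$. A nc subvariety of $\mathbb{D}_Q$ is a set of the form $\{X\in\mathbb{D}_Q:F(X)=0\ \forall F\in S\}$ with $S\subseteq H^\infty(\mathbb{D}_Q)$. *)

theory Defs
  imports "HOL-Analysis.L2_Norm" "Jordan_Normal_Form.Gauss_Jordan_Elimination"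
begin

section \<open>Complex Hilbert spaces and bounded operators\<close>

class complex_hilbert = banach +
  fixes scaleC :: "complex \<Rightarrow> 'a \<Rightarrow> 'a"  (infixr "*\<^sub>C" 75)
    and cinner :: "'a \<Rightarrow> 'a \<Rightarrow> complex"
  assumes scaleC_add_right: "a *\<^sub>C (x + y) = a *\<^sub>C x + a *\<^sub>C y"
    and scaleC_add_left: "(a + b) *\<^sub>C x = a *\<^sub>C x + b *\<^sub>C x"
    and scaleC_scaleC: "a *\<^sub>C (b *\<^sub>C x) = (a * b) *\<^sub>C x"
    and scaleR_scaleC: "r *\<^sub>R x = complex_of_real r *\<^sub>C x"
    and cinner_commute: "cinner x y = cnj (cinner y x)"
    and cinner_add_left: "cinner (x + y) z = cinner x z + cinner y z"
    and cinner_scaleC_left: "cinner (a *\<^sub>C x) y = a * cinner x y"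
    and cinner_self: "cinner x x = complex_of_real ((norm x)\<^sup>2)"

instantiation complex :: complex_hilbert
begin

definition scaleC_complex :: "complex \<Rightarrow> complex \<Rightarrow> complex"
  where "scaleC_complex a x = a * x"

definition cinner_complex :: "complex \<Rightarrow> complex \<Rightarrow> complex"
  where "cinner_complex x y = x * cnj y"

instance
proof
  fix a b x y z :: complex and r :: real
  show "a *\<^sub>C (x + y) = a *\<^sub>C x + a *\<^sub>C y" "(a + b) *\<^sub>C x = a *\<^sub>C x + b *\<^sub>C x"
    "a *\<^sub>C (b *\<^sub>C x) = (a * b) *\<^sub>C x"
    by (simp_all add: scaleC_complex_def distrib_left distrib_right mult.assoc)
  show "r *\<^sub>R x = complex_of_real r *\<^sub>C x"
    unfolding scaleC_complex_def by (rule scaleR_conv_of_real)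
  show "cinner x y = cnj (cinner y x)"
    by (simp add: cinner_complex_def mult.commute)
  show "cinner (x + y) z = cinner x z + cinner y z" "cinner (a *\<^sub>C x) y = a * cinner x y"
    by (simp_all add: cinner_complex_def scaleC_complex_def distrib_right mult.assoc)
  show "cinner x x = complex_of_real ((norm x)\<^sup>2)"
    unfolding cinner_complex_def by (rule complex_norm_square[symmetric])
qed

end

definition bounded_clinear :: "('r::complex_hilbert \<Rightarrow> 's::complex_hilbert) \<Rightarrow> bool"
  where "bounded_clinear T \<longleftrightarrow> bounded_linear T \<and> (\<forall>a x. T (a *\<^sub>C x) = a *\<^sub>C T x)"

definition clin_independent ::
    "('d::finite \<Rightarrow> 'r::complex_hilbert \<Rightarrow> 's::complex_hilbert) \<Rightarrow> bool"
  where "clin_independent Q \<longleftrightarrow>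
    (\<forall>c :: 'd \<Rightarrow> complex. (\<forall>x. (\<Sum>j\<in>UNIV. c j *\<^sub>C Q j x) = 0) \<longrightarrow> (\<forall>j. c j = 0))"


section \<open>The noncommutative universe\<close>

text \<open>
  A \<open>d\<close>-tuple of matrices is a function on an index type \<open>'d\<close> with \<open>CARD('d) = d\<close>.
  Since \<open>'d\<close> is nonempty, \<open>d \<ge> 1\<close> and the level of a tuple is determined by the tuple.
\<close>

type_synonym 'd tuple = "'d \<Rightarrow> complex mat"

definition mat_tuples :: "nat \<Rightarrow> 'd::finite tuple set"
  where "mat_tuples n = {X. \<forall>j. X j \<in> carrier_mat n n}"

definition nc_univ :: "'d::finite tuple set"
  where "nc_univ = (\<Union>n\<in>{1..}. mat_tuples n)"

definition nc_dsum :: "'d::finite tuple \<Rightarrow> 'd tuple \<Rightarrow> 'd tuple"  (infixr "\<oplus>\<^sub>n\<^sub>c" 65)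
  where "X \<oplus>\<^sub>n\<^sub>c Y = (\<lambda>j. four_block_mat
    (X j) (0\<^sub>m (dim_row (X j)) (dim_col (Y j)))
    (0\<^sub>m (dim_row (Y j)) (dim_col (X j))) (Y j))"

definition GL :: "nat \<Rightarrow> complex mat set"
  where "GL n = {S \<in> carrier_mat n n. invertible_mat S}"

definition nc_conj :: "complex mat \<Rightarrow> 'd::finite tuple \<Rightarrow> 'd tuple"  (infixr "\<cdot>\<^sub>n\<^sub>c" 70)
  where "S \<cdot>\<^sub>n\<^sub>c X = (\<lambda>j. the (mat_inverse S) * X j * S)"

definition nc_set :: "'d::finite tuple set \<Rightarrow> bool"
  where "nc_set \<Omega> \<longleftrightarrow> \<Omega> \<subseteq> nc_univ \<and> (\<forall>X\<in>\<Omega>. \<forall>Y\<in>\<Omega>. X \<oplus>\<^sub>n\<^sub>c Y \<in> \<Omega>)"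

definition nc_function :: "'d::finite tuple set \<Rightarrow> ('d tuple \<Rightarrow> 'e::finite tuple) \<Rightarrow> bool"
  where "nc_function \<Omega> F \<longleftrightarrow> nc_set \<Omega> \<and>
    (\<forall>n. \<forall>X \<in> \<Omega> \<inter> mat_tuples n. F X \<in> mat_tuples n) \<and>
    (\<forall>X\<in>\<Omega>. \<forall>Y\<in>\<Omega>. F (X \<oplus>\<^sub>n\<^sub>c Y) = F X \<oplus>\<^sub>n\<^sub>c F Y) \<and>
    (\<forall>n. \<forall>S \<in> GL n. \<forall>X \<in> \<Omega> \<inter> mat_tuples n.
      S \<cdot>\<^sub>n\<^sub>c X \<in> \<Omega> \<longrightarrow> F (S \<cdot>\<^sub>n\<^sub>c X) = S \<cdot>\<^sub>n\<^sub>c F X)"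


section \<open>Operator balls\<close>

text \<open>
  Vectors in the Hilbert space direct sum of \<open>n\<close> copies of a space are functions on
  \<open>nat\<close> of which only the values below \<open>n\<close> matter.
\<close>

definition norm_pow :: "nat \<Rightarrow> (nat \<Rightarrow> 'h::complex_hilbert) \<Rightarrow> real"
  where "norm_pow n v = L2_set (\<lambda>i. norm (v i)) {..<n}"

definition opnorm_pow ::
    "nat \<Rightarrow> ((nat \<Rightarrow> 'r::complex_hilbert) \<Rightarrow> (nat \<Rightarrow> 's::complex_hilbert)) \<Rightarrow> real"
  where "opnorm_pow n T = (SUP v \<in> {v. norm_pow n v \<le> 1}. norm_pow n (T v))"

text \<open>The operator \<open>\<Sum>\<^sub>j Q\<^sub>j \<otimes> X\<^sub>j\<close> for \<open>X\<close> at level \<open>n\<close>.\<close>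

definition nc_eval ::
    "('d::finite \<Rightarrow> 'r::complex_hilbert \<Rightarrow> 's::complex_hilbert) \<Rightarrow> nat \<Rightarrow> 'd tuple
      \<Rightarrow> (nat \<Rightarrow> 'r) \<Rightarrow> (nat \<Rightarrow> 's)"
  where "nc_eval Q n X v = (\<lambda>i. \<Sum>j\<in>UNIV. \<Sum>k<n. (X j $$ (i, k)) *\<^sub>C Q j (v k))"

definition nc_ball ::
    "('d::finite \<Rightarrow> 'r::complex_hilbert \<Rightarrow> 's::complex_hilbert) \<Rightarrow> 'd tuple set"
  where "nc_ball Q = (\<Union>n\<in>{1..}. {X \<in> mat_tuples n. opnorm_pow n (nc_eval Q n X) < 1})"

definition nc_closed_ball ::
    "('d::finite \<Rightarrow> 'r::complex_hilbert \<Rightarrow> 's::complex_hilbert) \<Rightarrow> 'd tuple set"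
  where "nc_closed_ball Q = (\<Union>n\<in>{1..}. {X \<in> mat_tuples n. opnorm_pow n (nc_eval Q n X) \<le> 1})"

definition nc_sphere ::
    "('d::finite \<Rightarrow> 'r::complex_hilbert \<Rightarrow> 's::complex_hilbert) \<Rightarrow> 'd tuple set"
  where "nc_sphere Q = (\<Union>n\<in>{1..}. {X \<in> mat_tuples n. opnorm_pow n (nc_eval Q n X) = 1})"


section \<open>Bounded nc functions and subvarieties\<close>

definition mat_opnorm :: "nat \<Rightarrow> complex mat \<Rightarrow> real"
  where "mat_opnorm n A = opnorm_pow n (\<lambda>v i. \<Sum>k<n. A $$ (i, k) * v k)"

text \<open>Scalar-valued functions are \<open>1\<close>-tuples, indexed by \<open>unit\<close>.\<close>

definition H_infty ::
    "('d::finite \<Rightarrow> 'r::complex_hilbert \<Rightarrow> 's::complex_hilbert) \<Rightarrow> ('d tuple \<Rightarrow> unit tuple) set"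
  where "H_infty Q = {F. nc_function (nc_ball Q) F \<and>
    (\<exists>C. \<forall>n. \<forall>X \<in> nc_ball Q \<inter> mat_tuples n. mat_opnorm n (F X ()) \<le> C)}"

definition nc_subvariety ::
    "('d::finite \<Rightarrow> 'r::complex_hilbert \<Rightarrow> 's::complex_hilbert) \<Rightarrow> 'd tuple set \<Rightarrow> bool"
  where "nc_subvariety Q V \<longleftrightarrow> (\<exists>\<F> \<subseteq> H_infty Q.
    V = {X \<in> nc_ball Q. \<forall>F\<in>\<F>. \<forall>n. X \<in> mat_tuples n \<longrightarrow> F X () = 0\<^sub>m n n})"

end

theory Submission imports Defs begin

text \<open>
  Suppose \<open>X\<close> and \<open>Y\<close> lie in the subvariety at levels \<open>n\<close> and \<open>m\<close>. For every \<open>n\<close> by \<open>m\<close> matrix \<open>Z\<close>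
  the direct sum of \<open>X\<close> and \<open>Y\<close> is similar, through a unipotent shear, to the block triangular
  tuple with diagonal \<open>X\<close>, \<open>Y\<close> and corner \<open>XZ - ZY\<close>. When \<open>Z\<close> is small this tuple is still in the
  open ball (\<open>nc_triangle_in_ball\<close>), and the functions that cut out the subvariety respect
  similarity, so it is still in the subvariety (\<open>nc_subvariety_shear\<close>). A nc map \<open>F\<close> sends it to the
  triangular tuple with diagonal \<open>A = F(X)\<close>, \<open>D = F(Y)\<close> and corner \<open>AZ - ZD\<close>
  (\<open>nc_function_shear\<close>).

  If \<open>F\<close> maps into the closed ball of \<open>P\<close>, the last tuple is a contraction under \<open>P\<close>, and applying it
  to a vector \<open>(0, v)\<close> with \<open>v\<close> in the unit ball gives
  \<open>\<parallel>P(A)Zv - ZP(D)v\<parallel>\<^sup>2 + \<parallel>P(D)v\<parallel>\<^sup>2 \<le> 1\<close> (\<open>nc_triangle_contraction\<close>). If \<open>v\<close> almost attains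
  norm \<open>1\<close> under \<open>P(D)\<close>, this forces \<open>ZP(D)v\<close> to be close to \<open>P(A)Zv\<close>. Taking for \<open>Z\<close> a small
  multiple of a matrix unit compares a single coordinate of \<open>P(D)v\<close> with the same coordinate of
  \<open>v\<close> and the factor \<open>\<parallel>P(A)\<parallel>\<close> (\<open>coordinate_estimate\<close>). Summing over the coordinates,
  \<open>\<parallel>P(D)v\<parallel> \<le> \<parallel>P(A)\<parallel> + C s\<close> as soon as \<open>\<parallel>P(D)v\<parallel>\<^sup>2 \<ge> 1 - s\<^sup>2\<close>. If \<open>\<parallel>P(A)\<parallel> < 1\<close> this is impossible
  for small \<open>s\<close>, so \<open>\<parallel>P(D)\<parallel> < 1\<close> (\<open>strict_contraction_propagates\<close>). Both halves of the dichotomy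
  follow, because the closed ball is the disjoint union of the ball and the sphere.
\<close>

section \<open>Vectors over a complex Hilbert space\<close>

lemma scaleC_zero_left [simp]: "0 *\<^sub>C x = (0::'a::complex_hilbert)"
  using scaleC_add_left[of 0 0 x] by simp

lemma scaleC_zero_right [simp]: "a *\<^sub>C (0::'a::complex_hilbert) = 0"
  using scaleC_add_right[of a 0 "0::'a"] by simp

lemma scaleC_minus_left: "(- a) *\<^sub>C x = - (a *\<^sub>C (x::'a::complex_hilbert))"
  using scaleC_add_left[of "- a" a x] by (simp add: eq_neg_iff_add_eq_0)

lemma scaleC_diff_left: "(a - b) *\<^sub>C x = a *\<^sub>C (x::'a::complex_hilbert) - b *\<^sub>C x"
  using scaleC_add_left[of a "- b" x] by (simp add: scaleC_minus_left)

lemma scaleC_sum_right: "a *\<^sub>C (\<Sum>i\<in>I. f i) = (\<Sum>i\<in>I. a *\<^sub>C (f i::'a::complex_hilbert))"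
  by (induction I rule: infinite_finite_induct) (simp_all add: scaleC_add_right)

lemma norm_scaleC: "norm (a *\<^sub>C x) = cmod a * norm (x::'a::complex_hilbert)"
proof -
  have "cinner (a *\<^sub>C x) (a *\<^sub>C x) = a * cnj a * cinner x x"
    using cinner_commute[of x "a *\<^sub>C x"] cinner_commute[of x x]
    by (simp add: cinner_scaleC_left)
  then have "complex_of_real ((norm (a *\<^sub>C x))\<^sup>2) = complex_of_real ((cmod a * norm x)\<^sup>2)"
    by (simp add: cinner_self complex_norm_square[symmetric] power_mult_distrib)
  then have "(norm (a *\<^sub>C x))\<^sup>2 = (cmod a * norm x)\<^sup>2"
    using of_real_eq_iff by blast
  then show ?thesis by (simp add: power2_eq_iff_nonneg)
qed

lemma norm_pow_nonneg [simp]: "0 \<le> norm_pow n v"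
  by (simp add: norm_pow_def)

lemma norm_pow_zero [simp]: "norm_pow n (\<lambda>i. 0) = 0"
  by (simp add: norm_pow_def L2_set_def)

lemma norm_le_norm_pow: "i < n \<Longrightarrow> norm (v i) \<le> norm_pow n v"
  unfolding norm_pow_def by (rule member_le_L2_set) auto

lemma norm_pow_cong: "(\<And>i. i < n \<Longrightarrow> v i = w i) \<Longrightarrow> norm_pow n v = norm_pow n w"
  by (auto simp: norm_pow_def intro: L2_set_cong)

lemma norm_pow_le_sum: "norm_pow n v \<le> (\<Sum>i<n. norm (v i))"
  unfolding norm_pow_def by (rule L2_set_le_sum) simp

lemma norm_pow_scaleR: "norm_pow n (\<lambda>i. r *\<^sub>R v i) = \<bar>r\<bar> * norm_pow n v"
  by (simp add: norm_pow_def L2_set_right_distrib)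

lemma norm_pow_triangle: "norm_pow n (\<lambda>i. v i + w i) \<le> norm_pow n v + norm_pow n w"
proof -
  have "norm_pow n (\<lambda>i. v i + w i) \<le> L2_set (\<lambda>i. norm (v i) + norm (w i)) {..<n}"
    unfolding norm_pow_def by (rule L2_set_mono) (simp_all add: norm_triangle_ineq)
  also have "\<dots> \<le> norm_pow n v + norm_pow n w"
    unfolding norm_pow_def by (rule L2_set_triangle_ineq)
  finally show ?thesis .
qed

lemma norm_pow_power2: "(norm_pow n v)\<^sup>2 = (\<Sum>i<n. (norm (v i))\<^sup>2)"
  by (simp add: norm_pow_def L2_set_def sum_nonneg)

lemma sum_lessThan_add:
  "(\<Sum>k<n + m. f k) = (\<Sum>k<n. f k) + (\<Sum>k<m. f (n + k :: nat) :: 'a::comm_monoid_add)"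
  by (induction m) (simp_all add: add.assoc)

lemma norm_pow_add: "(norm_pow (n + m) v)\<^sup>2 = (norm_pow n v)\<^sup>2 + (norm_pow m (\<lambda>i. v (n + i)))\<^sup>2"
  by (simp add: norm_pow_power2 sum_lessThan_add)

section \<open>Evaluating an operator pencil\<close>

text \<open>
  The tuple \<open>B\<close> may be rectangular here: the off-diagonal corner of a block triangular tuple maps
  \<open>m\<close> coordinates to \<open>n\<close> coordinates.
\<close>

lemma nc_eval_bounded:
  assumes "\<forall>j. bounded_clinear (Q j)"
  shows "\<exists>K>0. \<forall>v. norm_pow n (nc_eval Q m B v) \<le> K * norm_pow m v"
proof -
  obtain k where k: "\<And>j x. norm (Q j x) \<le> k j * norm x" "\<And>j. 0 < k j"
  proof -
    have "\<exists>K>0. \<forall>x. norm (Q j x) \<le> norm x * K" for j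
      using assms bounded_linear.pos_bounded unfolding bounded_clinear_def by blast
    then obtain k where "\<forall>j. 0 < k j \<and> (\<forall>x. norm (Q j x) \<le> norm x * k j)"
      by metis
    then show ?thesis using that[of k] by (simp add: mult.commute)
  qed
  define K where "K = (\<Sum>i<n. \<Sum>j\<in>UNIV. \<Sum>l<m. cmod (B j $$ (i, l)) * k j)"
  have K0: "0 \<le> K" unfolding K_def using k(2) by (intro sum_nonneg) (simp add: less_imp_le)
  have "norm_pow n (nc_eval Q m B v) \<le> K * norm_pow m v" for v
  proof -
    have "norm (nc_eval Q m B v i)
        \<le> (\<Sum>j\<in>UNIV. \<Sum>l<m. cmod (B j $$ (i, l)) * k j) * norm_pow m v" for i
      unfolding nc_eval_def sum_distrib_right
    proof (intro order.trans[OF norm_sum] sum_mono)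
      fix j l assume "l \<in> {..<m}"
      then have "norm (Q j (v l)) \<le> k j * norm_pow m v"
        using k norm_le_norm_pow[of l m v]
        by (meson lessThan_iff less_imp_le mult_left_mono order.trans)
      then show "norm ((B j $$ (i, l)) *\<^sub>C Q j (v l)) \<le> cmod (B j $$ (i, l)) * k j * norm_pow m v"
        by (simp add: norm_scaleC mult.assoc mult_left_mono)
    qed
    then have "(\<Sum>i<n. norm (nc_eval Q m B v i)) \<le> K * norm_pow m v"
      unfolding K_def sum_distrib_right[of _ "{..<n}"] by (intro sum_mono) blast
    then show ?thesis using norm_pow_le_sum order.trans by blast
  qed
  then have "norm_pow n (nc_eval Q m B v) \<le> (K + 1) * norm_pow m v" for v
    by (simp add: distrib_right add_increasing2)
  then show ?thesis using K0 by (intro exI[of _ "K + 1"]) auto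
qed

lemma bdd_above_opnorm_pow:
  assumes "\<forall>j. bounded_clinear (Q j)"
  shows "bdd_above ((\<lambda>v. norm_pow n (nc_eval Q n X v)) ` {v. norm_pow n v \<le> 1})"
proof -
  obtain K where "0 < K" and K: "\<And>v. norm_pow n (nc_eval Q n X v) \<le> K * norm_pow n v"
    using nc_eval_bounded[OF assms] by blast
  have "norm_pow n (nc_eval Q n X v) \<le> K" if "norm_pow n v \<le> 1" for v
    using K[of v] mult_left_mono[OF that, of K] \<open>0 < K\<close> by linarith
  then show ?thesis by (intro bdd_aboveI2) auto
qed

lemma norm_pow_nc_eval_le_opnorm_pow:
  assumes "\<forall>j. bounded_clinear (Q j)" and "norm_pow n v \<le> 1"
  shows "norm_pow n (nc_eval Q n X v) \<le> opnorm_pow n (nc_eval Q n X)"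
  unfolding opnorm_pow_def
  by (rule cSUP_upper[OF _ bdd_above_opnorm_pow]) (use assms in auto)

lemma opnorm_pow_nonneg:
  assumes "\<forall>j. bounded_clinear (Q j)"
  shows "0 \<le> opnorm_pow n (nc_eval Q n X)"
  by (rule order.trans[OF norm_pow_nonneg norm_pow_nc_eval_le_opnorm_pow[OF assms, where v = "\<lambda>i. 0"]])
    simp

lemma nc_eval_scaleR:
  assumes "\<forall>j. bounded_clinear (Q j)"
  shows "nc_eval Q n X (\<lambda>i. r *\<^sub>R v i) = (\<lambda>i. r *\<^sub>R nc_eval Q n X v i)"
proof -
  have "Q j (r *\<^sub>R x) = r *\<^sub>R Q j x" for j x
    using assms by (simp add: bounded_clinear_def bounded_linear.linear linear_scale)
  then show ?thesis
    by (simp add: nc_eval_def scaleR_sum_right)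
      (simp add: scaleR_scaleC scaleC_scaleC mult.commute)
qed

lemma norm_pow_nc_eval_le:
  assumes "\<forall>j. bounded_clinear (Q j)"
  shows "norm_pow n (nc_eval Q n X v) \<le> opnorm_pow n (nc_eval Q n X) * norm_pow n v"
proof (cases "norm_pow n v = 0")
  case True
  then show ?thesis using nc_eval_bounded[OF assms, where n = n and m = n and B = X] by (metis mult_zero_right)
next
  case False
  define r where "r = inverse (norm_pow n v)"
  have r: "r * norm_pow n v = 1" "0 < r"
    using False norm_pow_nonneg[of n v] by (auto simp: r_def less_le)
  have "norm_pow n (nc_eval Q n X (\<lambda>i. r *\<^sub>R v i)) \<le> opnorm_pow n (nc_eval Q n X)"
    using r by (intro norm_pow_nc_eval_le_opnorm_pow assms) (simp add: norm_pow_scaleR)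
  then have "r * norm_pow n (nc_eval Q n X v) \<le> opnorm_pow n (nc_eval Q n X)"
    using r by (simp add: nc_eval_scaleR[OF assms] norm_pow_scaleR)
  then show ?thesis using False norm_pow_nonneg[of n v] by (simp add: r_def field_simps)
qed

lemma opnorm_pow_leI:
  fixes T :: "(nat \<Rightarrow> 'r::complex_hilbert) \<Rightarrow> nat \<Rightarrow> 's::complex_hilbert"
  assumes "\<And>v. norm_pow n (T v) \<le> c * norm_pow n v" and "0 \<le> c"
  shows "opnorm_pow n T \<le> c"
  unfolding opnorm_pow_def
proof (rule cSUP_least)
  show "{v :: nat \<Rightarrow> 'r. norm_pow n v \<le> 1} \<noteq> {}" by (auto intro!: exI[of _ "\<lambda>i. 0"])
next
  fix v :: "nat \<Rightarrow> 'r" assume "v \<in> {v. norm_pow n v \<le> 1}"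
  then show "norm_pow n (T v) \<le> c"
    using assms(1)[of v] mult_left_mono[of "norm_pow n v" 1 c] assms(2) by simp
qed

section \<open>Block triangular tuples\<close>

text \<open>
  The zero block has the size that it has in a direct sum, so that a shear of \<open>X \<oplus>\<^sub>n\<^sub>c Y\<close> is
  literally a triangular tuple.
\<close>

definition nc_triangle :: "'d::finite tuple \<Rightarrow> 'd tuple \<Rightarrow> 'd tuple \<Rightarrow> 'd tuple"
  where "nc_triangle X B Y =
    (\<lambda>j. four_block_mat (X j) (B j) (0\<^sub>m (dim_row (Y j)) (dim_col (X j))) (Y j))"

lemma nc_triangle_mat_tuples:
  "X \<in> mat_tuples n \<Longrightarrow> Y \<in> mat_tuples m \<Longrightarrow> nc_triangle X B Y \<in> mat_tuples (n + m)"
  by (auto simp: mat_tuples_def nc_triangle_def)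

lemma mat_tuples_unique: "X \<in> mat_tuples n \<Longrightarrow> X \<in> mat_tuples m \<Longrightarrow> m = n"
  unfolding mat_tuples_def by (metis (mono_tags) carrier_matD(1) mem_Collect_eq)

lemma nc_eval_triangle_upper:
  assumes "X \<in> mat_tuples n" "Y \<in> mat_tuples m" and "i < n"
  shows "nc_eval Q (n + m) (nc_triangle X B Y) v i
    = nc_eval Q n X v i + nc_eval Q m B (\<lambda>k. v (n + k)) i"
proof -
  have "dim_row (X j) = n" "dim_col (X j) = n" "dim_row (Y j) = m" "dim_col (Y j) = m" for j
    using assms by (auto simp: mat_tuples_def)
  then show ?thesis
    using assms(3) by (simp add: nc_eval_def nc_triangle_def sum_lessThan_add sum.distrib)
qed

lemma nc_eval_triangle_lower:
  assumes "X \<in> mat_tuples n" "Y \<in> mat_tuples m" and "i < m"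
  shows "nc_eval Q (n + m) (nc_triangle X B Y) v (n + i) = nc_eval Q m Y (\<lambda>k. v (n + k)) i"
proof -
  have "dim_row (X j) = n" "dim_col (X j) = n" "dim_row (Y j) = m" "dim_col (Y j) = m" for j
    using assms by (auto simp: mat_tuples_def)
  then show ?thesis
    using assms(3) by (simp add: nc_eval_def nc_triangle_def sum_lessThan_add sum.distrib)
qed

lemma nc_eval_smult:
  assumes "\<And>j. B j \<in> carrier_mat n m" and "i < n"
  shows "nc_eval Q m (\<lambda>j. c \<cdot>\<^sub>m B j) v i = c *\<^sub>C nc_eval Q m B v i"
proof -
  have "dim_row (B j) = n" "dim_col (B j) = m" for j
    using assms(1)[of j] by auto
  then show ?thesis
    using assms(2) by (simp add: nc_eval_def scaleC_sum_right scaleC_scaleC)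
qed

text \<open>
  The ball is open: the diagonal part has norm \<open>\<rho> < 1\<close>, the larger of the norms at \<open>X\<close> and \<open>Y\<close>, and
  the corner adds at most a multiple of \<open>c\<close>.
\<close>

lemma nc_triangle_in_ball:
  assumes Q: "\<forall>j. bounded_clinear (Q j)"
    and X: "X \<in> mat_tuples n" "X \<in> nc_ball Q" and Y: "Y \<in> mat_tuples m" "Y \<in> nc_ball Q"
    and B: "\<And>j. B j \<in> carrier_mat n m"
  shows "\<exists>c>0. nc_triangle X (\<lambda>j. complex_of_real c \<cdot>\<^sub>m B j) Y \<in> nc_ball Q"
proof -
  define \<rho> where "\<rho> = max (opnorm_pow n (nc_eval Q n X)) (opnorm_pow m (nc_eval Q m Y))"
  have \<rho>: "0 \<le> \<rho>" "\<rho> < 1" and n: "1 \<le> n"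
    using X Y opnorm_pow_nonneg[OF Q, where n = n and X = X]
    by (auto simp: \<rho>_def nc_ball_def dest: mat_tuples_unique)
  obtain K where "0 < K" and K: "\<And>v. norm_pow n (nc_eval Q m B v) \<le> K * norm_pow m v"
    using nc_eval_bounded[OF Q] by blast
  \<comment> \<open>The corner then has norm at most half of the gap \<open>1 - \<rho>\<close>.\<close>
  define c where "c = (1 - \<rho>) / (2 * K)"
  have "0 < c" using \<rho> \<open>0 < K\<close> by (simp add: c_def)
  let ?T = "nc_triangle X (\<lambda>j. complex_of_real c \<cdot>\<^sub>m B j) Y"
  have "norm_pow (n + m) (nc_eval Q (n + m) ?T v) \<le> (\<rho> + c * K) * norm_pow (n + m) v" for v
  proof -
    \<comment> \<open>The image of \<open>v\<close> is the sum of the contribution \<open>d\<close> of the diagonal and \<open>u\<close> of the corner.\<close>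
    define w where "w = (\<lambda>k. v (n + k))"
    define d where "d i = (if i < n then nc_eval Q n X v i else nc_eval Q m Y w (i - n))" for i
    define u where "u i = (if i < n then c *\<^sub>R nc_eval Q m B w i else 0)" for i
    have split: "nc_eval Q (n + m) ?T v i = d i + u i" if "i < n + m" for i
    proof (cases "i < n")
      case True
      then show ?thesis
        by (simp add: nc_eval_triangle_upper[OF X(1) Y(1)] nc_eval_smult[OF B] d_def u_def
            w_def scaleR_scaleC)
    next
      case False
      then show ?thesis
        using nc_eval_triangle_lower[OF X(1) Y(1), of "i - n" Q _ v] that
        by (simp add: d_def u_def w_def)
    qed
    have w: "norm_pow m w \<le> norm_pow (n + m) v"
      by (rule power2_le_imp_le) (simp_all add: norm_pow_add w_def)
    have "(norm_pow (n + m) d)\<^sup>2 = (norm_pow n (nc_eval Q n X v))\<^sup>2 + (norm_pow m (nc_eval Q m Y w))\<^sup>2"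
    proof -
      have "norm_pow n d = norm_pow n (nc_eval Q n X v)"
        by (rule norm_pow_cong) (simp add: d_def)
      moreover have "norm_pow m (\<lambda>i. d (n + i)) = norm_pow m (nc_eval Q m Y w)"
        by (rule norm_pow_cong) (simp add: d_def)
      ultimately show ?thesis by (simp only: norm_pow_add)
    qed
    also have "\<dots> \<le> (\<rho> * norm_pow n v)\<^sup>2 + (\<rho> * norm_pow m w)\<^sup>2"
    proof (intro add_mono power_mono norm_pow_nonneg)
      show "norm_pow n (nc_eval Q n X v) \<le> \<rho> * norm_pow n v"
        by (rule order.trans[OF norm_pow_nc_eval_le[OF Q]], rule mult_right_mono) (simp_all add: \<rho>_def)
      show "norm_pow m (nc_eval Q m Y w) \<le> \<rho> * norm_pow m w"
        by (rule order.trans[OF norm_pow_nc_eval_le[OF Q]], rule mult_right_mono) (simp_all add: \<rho>_def)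
    qed
    also have "\<dots> = (\<rho> * norm_pow (n + m) v)\<^sup>2"
      by (simp add: power_mult_distrib norm_pow_add w_def distrib_left)
    finally have d: "norm_pow (n + m) d \<le> \<rho> * norm_pow (n + m) v"
      by (rule power2_le_imp_le) (use \<rho> in simp)
    have "(norm_pow (n + m) u)\<^sup>2 = (norm_pow n (\<lambda>i. c *\<^sub>R nc_eval Q m B w i))\<^sup>2"
    proof -
      have "norm_pow n u = norm_pow n (\<lambda>i. c *\<^sub>R nc_eval Q m B w i)"
        by (rule norm_pow_cong) (simp add: u_def)
      moreover have "(\<lambda>i. u (n + i)) = (\<lambda>i. 0)" by (simp add: u_def)
      ultimately show ?thesis by (simp add: norm_pow_add)
    qed
    then have "norm_pow (n + m) u = c * norm_pow n (nc_eval Q m B w)"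
      using \<open>0 < c\<close> by (simp add: norm_pow_scaleR power2_eq_iff_nonneg)
    also have "\<dots> \<le> c * (K * norm_pow (n + m) v)"
      using \<open>0 < c\<close> \<open>0 < K\<close> w by (intro mult_left_mono order.trans[OF K]) simp_all
    finally have u: "norm_pow (n + m) u \<le> c * K * norm_pow (n + m) v" by simp
    have "norm_pow (n + m) (nc_eval Q (n + m) ?T v) = norm_pow (n + m) (\<lambda>i. d i + u i)"
      by (rule norm_pow_cong) (rule split)
    also have "\<dots> \<le> (\<rho> + c * K) * norm_pow (n + m) v"
      using norm_pow_triangle[of "n + m" d u] d u by (simp add: distrib_right)
    finally show ?thesis .
  qed
  then have "opnorm_pow (n + m) (nc_eval Q (n + m) ?T) \<le> \<rho> + c * K"
    using \<rho> \<open>0 < c\<close> \<open>0 < K\<close> by (intro opnorm_pow_leI) auto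
  also have "\<rho> + c * K < 1" using \<rho> \<open>0 < K\<close> by (simp add: c_def field_simps)
  finally show ?thesis
    using \<open>0 < c\<close> n nc_triangle_mat_tuples[OF X(1) Y(1)]
    unfolding nc_ball_def by (intro exI[of _ c]) (auto intro!: bexI[of _ "n + m"])
qed

section \<open>Shears\<close>

definition shear :: "nat \<Rightarrow> nat \<Rightarrow> complex mat \<Rightarrow> complex mat"
  where "shear n m Z = four_block_mat (1\<^sub>m n) Z (0\<^sub>m m n) (1\<^sub>m m)"

lemma shear_carrier [simp]: "shear n m Z \<in> carrier_mat (n + m) (n + m)"
  by (simp add: shear_def)

lemma shear_mult_uminus:
  assumes "Z \<in> carrier_mat n m"
  shows "shear n m Z * shear n m (- Z) = 1\<^sub>m (n + m)"
proof -
  have "1\<^sub>m n * (- Z) + Z * 1\<^sub>m m = 0\<^sub>m n m" "0\<^sub>m m n * (- Z) + 1\<^sub>m m * 1\<^sub>m m = 1\<^sub>m m"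
    using assms by (auto intro!: eq_matI)
  then show ?thesis
  unfolding shear_def
  by (subst mult_four_block_mat[where ?nr1.0 = n and ?n1.0 = n and ?nr2.0 = m and ?n2.0 = m
        and ?nc1.0 = n and ?nc2.0 = m])
    (use assms in \<open>simp_all add: four_block_one_mat del: left_mult_zero_mat\<close>)
qed

lemma shear_inverse:
  assumes Z: "Z \<in> carrier_mat n m"
  shows "shear n m Z \<in> GL (n + m)" and "the (mat_inverse (shear n m Z)) = shear n m (- Z)"
proof -
  have 1: "shear n m Z * shear n m (- Z) = 1\<^sub>m (n + m)"
    by (rule shear_mult_uminus[OF Z])
  have 2: "shear n m (- Z) * shear n m Z = 1\<^sub>m (n + m)"
    using shear_mult_uminus[of "- Z" n m] Z by simp
  show "shear n m Z \<in> GL (n + m)"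
    unfolding GL_def invertible_mat_def inverts_mat_def
    using 1 2 by (auto simp: shear_def intro!: exI[of _ "shear n m (- Z)"])
  show "the (mat_inverse (shear n m Z)) = shear n m (- Z)"
  proof (cases "mat_inverse (shear n m Z)")
    case None
    then show ?thesis
      using mat_inverse(1)[OF shear_carrier None] 1 2
      by (auto simp: Units_def ring_mat_simps)
  next
    case (Some C)
    from mat_inverse(2)[OF shear_carrier Some]
    have C: "C * shear n m Z = 1\<^sub>m (n + m)" "C \<in> carrier_mat (n + m) (n + m)" by auto
    have "C = C * (shear n m Z * shear n m (- Z))" using C(2) by (simp add: 1)
    also have "\<dots> = C * shear n m Z * shear n m (- Z)"
      by (rule assoc_mult_mat[symmetric, OF C(2)]) (rule shear_carrier)+
    also have "\<dots> = shear n m (- Z)" unfolding C(1) by (rule left_mult_one_mat[OF shear_carrier])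
    finally show ?thesis using Some by simp
  qed
qed

lemma commutator_carrier:
  assumes "A \<in> carrier_mat n n" "E \<in> carrier_mat n m" "D \<in> carrier_mat m m"
  shows "A * E - E * D \<in> carrier_mat n m"
  using assms by (metis minus_carrier_mat mult_carrier_mat)

lemma commutator_smult:
  fixes c :: complex
  assumes A: "A \<in> carrier_mat n n" and E: "E \<in> carrier_mat n m" and D: "D \<in> carrier_mat m m"
  shows "A * (c \<cdot>\<^sub>m E) - (c \<cdot>\<^sub>m E) * D = c \<cdot>\<^sub>m (A * E - E * D)"
proof -
  have "c \<cdot>\<^sub>m (A * E) - c \<cdot>\<^sub>m (E * D) = c \<cdot>\<^sub>m (A * E - E * D)"
    using mult_carrier_mat[OF A E] mult_carrier_mat[OF E D]
    by (intro eq_matI) (auto simp del: index_mult_mat simp: right_diff_distrib carrier_matD)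
  then show ?thesis
    by (simp add: mult_smult_distrib[OF A E] mult_smult_assoc_mat[OF E D])
qed

lemma nc_conj_shear_dsum:
  assumes "X \<in> mat_tuples n" "Y \<in> mat_tuples m" and Z: "Z \<in> carrier_mat n m"
  shows "shear n m Z \<cdot>\<^sub>n\<^sub>c (X \<oplus>\<^sub>n\<^sub>c Y) = nc_triangle X (\<lambda>j. X j * Z - Z * Y j) Y"
proof
  fix j
  have X: "X j \<in> carrier_mat n n" and Y: "Y j \<in> carrier_mat m m"
    using assms by (auto simp: mat_tuples_def)
  have "shear n m (- Z) * four_block_mat (X j) (0\<^sub>m n m) (0\<^sub>m m n) (Y j)
      = four_block_mat (X j) (- (Z * Y j)) (0\<^sub>m m n) (Y j)"
    unfolding shear_def
    by (subst mult_four_block_mat[where ?nr1.0 = n and ?n1.0 = n and ?nr2.0 = m and ?n2.0 = m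
          and ?nc1.0 = n and ?nc2.0 = m]) (use X Y Z in auto)
  moreover have "four_block_mat (X j) (- (Z * Y j)) (0\<^sub>m m n) (Y j) * shear n m Z
      = four_block_mat (X j) (X j * Z + - (Z * Y j)) (0\<^sub>m m n) (Y j)"
    unfolding shear_def
    by (subst mult_four_block_mat[where ?nr1.0 = n and ?n1.0 = n and ?nr2.0 = m and ?n2.0 = m
          and ?nc1.0 = n and ?nc2.0 = m]) (use X Y Z in auto)
  moreover have "X j * Z + - (Z * Y j) = X j * Z - Z * Y j"
    using X Y Z by (intro eq_matI) auto
  ultimately show "(shear n m Z \<cdot>\<^sub>n\<^sub>c (X \<oplus>\<^sub>n\<^sub>c Y)) j = nc_triangle X (\<lambda>j. X j * Z - Z * Y j) Y j"
    using X Y by (simp add: nc_conj_def nc_dsum_def nc_triangle_def shear_inverse(2)[OF Z])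
qed

text \<open>
  The shear acts on \<open>F X \<oplus>\<^sub>n\<^sub>c F Y\<close> by the formula by which it acts on \<open>X \<oplus>\<^sub>n\<^sub>c Y\<close>, so a nc function
  carries the commutator corner to the commutator corner of the values. The domain has to contain
  the sheared tuple, since nc functions respect only the similarities that stay in their domain.
\<close>

lemma nc_function_shear:
  assumes F: "nc_function V F" and X: "X \<in> V" "X \<in> mat_tuples n" and Y: "Y \<in> V" "Y \<in> mat_tuples m"
    and Z: "Z \<in> carrier_mat n m" and V: "nc_triangle X (\<lambda>j. X j * Z - Z * Y j) Y \<in> V"
  shows "F (nc_triangle X (\<lambda>j. X j * Z - Z * Y j) Y)
    = nc_triangle (F X) (\<lambda>j. F X j * Z - Z * F Y j) (F Y)"
proof -
  have D: "X \<oplus>\<^sub>n\<^sub>c Y \<in> V" "X \<oplus>\<^sub>n\<^sub>c Y \<in> mat_tuples (n + m)"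
    using F X Y by (auto simp: nc_function_def nc_set_def mat_tuples_def nc_dsum_def)
  have FXY: "F X \<in> mat_tuples n" "F Y \<in> mat_tuples m"
    using F X Y by (auto simp: nc_function_def)
  have "\<forall>S\<in>GL (n + m). \<forall>W\<in>V \<inter> mat_tuples (n + m).
      S \<cdot>\<^sub>n\<^sub>c W \<in> V \<longrightarrow> F (S \<cdot>\<^sub>n\<^sub>c W) = S \<cdot>\<^sub>n\<^sub>c F W"
    using F unfolding nc_function_def by blast
  from bspec[OF bspec[OF this shear_inverse(1)[OF Z]] IntI[OF D]]
  have "F (shear n m Z \<cdot>\<^sub>n\<^sub>c (X \<oplus>\<^sub>n\<^sub>c Y)) = shear n m Z \<cdot>\<^sub>n\<^sub>c F (X \<oplus>\<^sub>n\<^sub>c Y)"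
    using V by (simp add: nc_conj_shear_dsum[OF X(2) Y(2) Z])
  also have "F (X \<oplus>\<^sub>n\<^sub>c Y) = F X \<oplus>\<^sub>n\<^sub>c F Y"
    using F X Y by (simp add: nc_function_def)
  finally show ?thesis
    by (simp add: nc_conj_shear_dsum[OF X(2) Y(2) Z] nc_conj_shear_dsum[OF FXY Z])
qed

text \<open>
  A defining function vanishes at \<open>X\<close> and \<open>Y\<close>, so its value at the sheared tuple is triangular
  with zero diagonal and with corner \<open>0 Z - Z 0\<close>.
\<close>

lemma nc_subvariety_shear:
  assumes V: "nc_subvariety Q V" "nc_set V"
    and X: "X \<in> V" "X \<in> mat_tuples n" and Y: "Y \<in> V" "Y \<in> mat_tuples m"
    and Z: "Z \<in> carrier_mat n m" and T: "nc_triangle X (\<lambda>j. X j * Z - Z * Y j) Y \<in> nc_ball Q"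
  shows "nc_triangle X (\<lambda>j. X j * Z - Z * Y j) Y \<in> V"
proof -
  let ?T = "nc_triangle X (\<lambda>j. X j * Z - Z * Y j) Y"
  obtain \<F> where \<F>: "\<F> \<subseteq> H_infty Q"
    "V = {X \<in> nc_ball Q. \<forall>F\<in>\<F>. \<forall>n. X \<in> mat_tuples n \<longrightarrow> F X () = 0\<^sub>m n n}"
    using V(1) by (auto simp: nc_subvariety_def)
  have T': "?T \<in> mat_tuples (n + m)"
    by (rule nc_triangle_mat_tuples[OF X(2) Y(2)])
  have "f ?T () = 0\<^sub>m k k" if "f \<in> \<F>" and "?T \<in> mat_tuples k" for f k
  proof -
    have k: "k = n + m" using mat_tuples_unique[OF T' that(2)] .
    have "nc_function (nc_ball Q) f"
      using \<F>(1) that(1) by (auto simp: H_infty_def)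
    moreover have "X \<in> nc_ball Q" "Y \<in> nc_ball Q" "f X () = 0\<^sub>m n n" "f Y () = 0\<^sub>m m m"
      using X Y that(1) \<F>(2) by auto
    ultimately have "f ?T () = nc_triangle (f X) (\<lambda>j. f X j * Z - Z * f Y j) (f Y) ()"
      using nc_function_shear[of "nc_ball Q" f X n Y m Z] X(2) Y(2) Z T by simp
    also have "\<dots> = 0\<^sub>m k k"
      unfolding nc_triangle_def k \<open>f X () = 0\<^sub>m n n\<close> \<open>f Y () = 0\<^sub>m m m\<close>
      using Z by (intro eq_matI) auto
    finally show ?thesis .
  qed
  then show ?thesis using T \<F>(2) by blast
qed

section \<open>The maximum principle\<close>

text \<open>Apply the contraction to the vector whose first \<open>n\<close> coordinates vanish and that continues with \<open>v\<close>.\<close>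

lemma nc_triangle_contraction:
  assumes P: "\<forall>j. bounded_clinear (P j)"
    and X: "X \<in> mat_tuples n" and Y: "Y \<in> mat_tuples m"
    and T: "opnorm_pow (n + m) (nc_eval P (n + m) (nc_triangle X B Y)) \<le> 1"
    and v: "norm_pow m v \<le> 1"
  shows "(norm_pow n (nc_eval P m B v))\<^sup>2 + (norm_pow m (nc_eval P m Y v))\<^sup>2 \<le> 1"
proof -
  let ?T = "nc_eval P (n + m) (nc_triangle X B Y)"
  define u where "u i = (if i < n then 0 else v (i - n))" for i
  have tail: "(\<lambda>k. u (n + k)) = v" by (simp add: u_def)
  have "P j 0 = 0" for j
    using P by (simp add: bounded_clinear_def bounded_linear.linear linear_0)
  then have head: "nc_eval P n X u i = 0" for i
    by (simp add: nc_eval_def u_def)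
  have "norm_pow n u = 0"
    using norm_pow_cong[of n u "\<lambda>i. 0"] by (simp add: u_def)
  then have "(norm_pow (n + m) u)\<^sup>2 = (norm_pow m v)\<^sup>2"
    by (simp add: norm_pow_add tail)
  then have "norm_pow (n + m) u \<le> 1" using v by (simp add: power2_eq_iff_nonneg)
  then have "norm_pow (n + m) (?T u) \<le> 1"
    using norm_pow_nc_eval_le_opnorm_pow[OF P] T order.trans by blast
  then have "(norm_pow (n + m) (?T u))\<^sup>2 \<le> 1"
    by (simp add: power_le_one)
  moreover have "norm_pow n (?T u) = norm_pow n (nc_eval P m B v)"
    by (rule norm_pow_cong) (simp add: nc_eval_triangle_upper[OF X Y] tail head)
  moreover have "norm_pow m (\<lambda>i. ?T u (n + i)) = norm_pow m (nc_eval P m Y v)"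
    by (rule norm_pow_cong) (simp add: nc_eval_triangle_lower[OF X Y] tail)
  ultimately show ?thesis by (simp add: norm_pow_add)
qed

text \<open>The \<open>(0, 0)\<close> entry of the operator matrix is one of its compressions.\<close>

lemma nc_eval_corner:
  assumes P: "\<forall>j. bounded_clinear (P j)" and n: "1 \<le> n"
  shows "norm (\<Sum>j\<in>UNIV. (X j $$ (0, 0)) *\<^sub>C P j x) \<le> opnorm_pow n (nc_eval P n X) * norm x"
proof -
  define u where "u k = (if k = 0 then x else 0)" for k :: nat
  have "P j 0 = 0" for j
    using P by (simp add: bounded_clinear_def bounded_linear.linear linear_0)
  then have "(\<Sum>k<n. (X j $$ (0, k)) *\<^sub>C P j (u k)) = (X j $$ (0, 0)) *\<^sub>C P j x" for j
    using n by (subst sum.mono_neutral_right[of _ "{0}"]) (auto simp: u_def)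
  then have "norm (\<Sum>j\<in>UNIV. (X j $$ (0, 0)) *\<^sub>C P j x) = norm (nc_eval P n X u 0)"
    by (simp add: nc_eval_def)
  also have "\<dots> \<le> norm_pow n (nc_eval P n X u)"
    using n by (intro norm_le_norm_pow) simp
  also have "\<dots> \<le> opnorm_pow n (nc_eval P n X) * norm_pow n u"
    by (rule norm_pow_nc_eval_le[OF P])
  also have "(norm_pow n u)\<^sup>2 = (norm x)\<^sup>2"
    using n by (subst norm_pow_power2, subst sum.mono_neutral_right[of _ "{0}"]) (auto simp: u_def)
  then have "norm_pow n u = norm x" by (simp add: power2_eq_iff_nonneg)
  finally show ?thesis by simp
qed

text \<open>
  The matrix unit \<open>E\<^sub>0\<^sub>i\<close>. Multiplication by it moves coordinate \<open>i\<close> to coordinate \<open>0\<close>, which exists at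
  every level \<open>n \<ge> 1\<close>, also when \<open>n\<close> is smaller than \<open>m\<close>.
\<close>

definition corner_unit :: "nat \<Rightarrow> nat \<Rightarrow> nat \<Rightarrow> complex mat"
  where "corner_unit n m i = mat n m (\<lambda>(r, k). if r = 0 \<and> k = i then 1 else 0)"

lemma corner_unit_carrier [simp]: "corner_unit n m i \<in> carrier_mat n m"
  by (simp add: corner_unit_def)

lemma corner_unit_commutator:
  assumes "X \<in> carrier_mat n n" "Y \<in> carrier_mat m m" "1 \<le> n" "i < m" "k < m"
  shows "(X * corner_unit n m i - corner_unit n m i * Y) $$ (0, k)
    = (if k = i then X $$ (0, 0) else 0) - Y $$ (i, k)"
proof -
  have "(X * corner_unit n m i) $$ (0, k) = (\<Sum>l<n. X $$ (0, l) * (if l = 0 \<and> k = i then 1 else 0))"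
    using assms by (simp add: corner_unit_def scalar_prod_def atLeast0LessThan)
  also have "\<dots> = (if k = i then X $$ (0, 0) else 0)"
    using assms by (subst sum.mono_neutral_right[of _ "{0}"]) auto
  finally have 1: "(X * corner_unit n m i) $$ (0, k) = (if k = i then X $$ (0, 0) else 0)" .
  have "(corner_unit n m i * Y) $$ (0, k) = (\<Sum>l<m. (if l = i then 1 else 0) * Y $$ (l, k))"
    using assms by (simp add: corner_unit_def scalar_prod_def atLeast0LessThan)
  also have "\<dots> = Y $$ (i, k)"
    using assms by (subst sum.mono_neutral_right[of _ "{i}"]) auto
  finally have 2: "(corner_unit n m i * Y) $$ (0, k) = Y $$ (i, k)" .
  show ?thesis using assms 1 2 by (simp add: corner_unit_def)
qed

text \<open>
  Only the coordinate \<open>0\<close> of \<open>P(X)Zv - ZP(Y)v\<close> is used for \<open>Z = E\<^sub>0\<^sub>i\<close>: it compares coordinate \<open>i\<close> of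
  \<open>P(Y)v\<close> with an operator of norm at most \<open>\<parallel>P(X)\<parallel>\<close> applied to coordinate \<open>i\<close> of \<open>v\<close>.
\<close>

lemma nc_eval_commutator:
  assumes "X \<in> mat_tuples n" "Y \<in> mat_tuples m" "1 \<le> n" "i < m"
  shows "nc_eval P m (\<lambda>j. X j * corner_unit n m i - corner_unit n m i * Y j) v 0
    = (\<Sum>j\<in>UNIV. (X j $$ (0, 0)) *\<^sub>C P j (v i)) - nc_eval P m Y v i"
proof -
  have "(\<Sum>k<m. ((X j * corner_unit n m i - corner_unit n m i * Y j) $$ (0, k)) *\<^sub>C P j (v k))
      = (X j $$ (0, 0)) *\<^sub>C P j (v i) - (\<Sum>k<m. (Y j $$ (i, k)) *\<^sub>C P j (v k))" for j
  proof -
    have "(\<Sum>k<m. ((X j * corner_unit n m i - corner_unit n m i * Y j) $$ (0, k)) *\<^sub>C P j (v k))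
      = (\<Sum>k<m. (if k = i then X j $$ (0, 0) else 0) *\<^sub>C P j (v k) - (Y j $$ (i, k)) *\<^sub>C P j (v k))"
      using assms by (intro sum.cong)
        (auto simp: corner_unit_commutator mat_tuples_def scaleC_diff_left scaleC_minus_left)
    moreover have "(\<Sum>k<m. (if k = i then X j $$ (0, 0) else 0) *\<^sub>C P j (v k)) = (X j $$ (0, 0)) *\<^sub>C P j (v i)"
      using assms by (subst sum.mono_neutral_right[of _ "{i}"]) auto
    ultimately show ?thesis by (simp add: sum_subtractf)
  qed
  then show ?thesis by (simp add: nc_eval_def sum_subtractf)
qed

text \<open>
  If \<open>c E\<^sub>0\<^sub>i\<close> is small enough for the shear of \<open>X \<oplus>\<^sub>n\<^sub>c Y\<close> to remain in the ball, the defect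
  \<open>1 - \<parallel>P(F(Y))v\<parallel>\<^sup>2 \<le> s\<^sup>2\<close> bounds the action on \<open>v\<close> of the corner at the sheared tuple, whose
  coordinate \<open>0\<close> is \<open>c\<close> times the difference to be estimated; hence \<open>C = 1 / c\<close>. The constant is independent of \<open>v\<close>
  and \<open>s\<close>, so that \<open>v\<close> can run through an almost maximising family; a maximising vector need not
  exist in infinite dimensions.
\<close>

lemma coordinate_estimate:
  assumes Q: "\<forall>j. bounded_clinear (Q j)" and P: "\<forall>j. bounded_clinear (P j)"
    and V: "nc_subvariety Q V" and F: "nc_function V F" and FV: "F ` V \<subseteq> nc_closed_ball P"
    and X: "X \<in> V" "X \<in> mat_tuples n" and Y: "Y \<in> V" "Y \<in> mat_tuples m"
    and n: "1 \<le> n" and i: "i < m"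
  shows "\<exists>C\<ge>0. \<forall>v s. norm_pow m v \<le> 1 \<longrightarrow> 0 \<le> s \<longrightarrow> 1 - s\<^sup>2 \<le> (norm_pow m (nc_eval P m (F Y) v))\<^sup>2
    \<longrightarrow> norm (nc_eval P m (F Y) v i) \<le> opnorm_pow n (nc_eval P n (F X)) * norm (v i) + C * s"
proof -
  let ?E = "corner_unit n m i"
  have VQ: "X \<in> nc_ball Q" "Y \<in> nc_ball Q"
    using V X Y by (auto simp: nc_subvariety_def)
  have FX: "F X \<in> mat_tuples n" and FY: "F Y \<in> mat_tuples m" and ncV: "nc_set V"
    using F X Y by (auto simp: nc_function_def)
  have comm: "(\<lambda>j. A j * (c \<cdot>\<^sub>m ?E) - (c \<cdot>\<^sub>m ?E) * D j) = (\<lambda>j. c \<cdot>\<^sub>m (A j * ?E - ?E * D j))"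
    and carr: "A j * ?E - ?E * D j \<in> carrier_mat n m"
    if "A \<in> mat_tuples n" "D \<in> mat_tuples m" for c j and A D :: "'x::finite tuple"
  proof -
    have A: "A k \<in> carrier_mat n n" and D: "D k \<in> carrier_mat m m" for k
      using that by (auto simp: mat_tuples_def)
    show "(\<lambda>j. A j * (c \<cdot>\<^sub>m ?E) - (c \<cdot>\<^sub>m ?E) * D j) = (\<lambda>j. c \<cdot>\<^sub>m (A j * ?E - ?E * D j))"
      by (rule ext) (rule commutator_smult[OF A corner_unit_carrier D])
    show "A j * ?E - ?E * D j \<in> carrier_mat n m"
      by (rule commutator_carrier[OF A corner_unit_carrier D])
  qed
  obtain c where c: "0 < c"
    and ball: "nc_triangle X (\<lambda>j. complex_of_real c \<cdot>\<^sub>m (X j * ?E - ?E * Y j)) Y \<in> nc_ball Q"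
    using nc_triangle_in_ball[where B = "\<lambda>j. X j * ?E - ?E * Y j",
        OF Q X(2) VQ(1) Y(2) VQ(2) carr[OF X(2) Y(2)]] by (elim exE conjE)
  define Z where "Z = complex_of_real c \<cdot>\<^sub>m ?E"
  have Z: "Z \<in> carrier_mat n m" by (simp add: Z_def)
  let ?T = "nc_triangle X (\<lambda>j. X j * Z - Z * Y j) Y"
  have "?T \<in> nc_ball Q"
    unfolding Z_def by (subst comm[OF X(2) Y(2)]) (rule ball)
  then have "?T \<in> V"
    by (rule nc_subvariety_shear[OF V ncV X Y Z])
  define B where "B = (\<lambda>j. F X j * ?E - ?E * F Y j)"
  have "F ?T = nc_triangle (F X) (\<lambda>j. complex_of_real c \<cdot>\<^sub>m B j) (F Y)"
    using nc_function_shear[OF F X Y Z \<open>?T \<in> V\<close>] comm[OF FX FY, of "complex_of_real c"]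
    unfolding Z_def B_def by (rule trans[OF _ arg_cong])
  then have "nc_triangle (F X) (\<lambda>j. complex_of_real c \<cdot>\<^sub>m B j) (F Y) \<in> nc_closed_ball P"
    using FV \<open>?T \<in> V\<close> by (metis image_subset_iff)
  then have T: "opnorm_pow (n + m) (nc_eval P (n + m)
      (nc_triangle (F X) (\<lambda>j. complex_of_real c \<cdot>\<^sub>m B j) (F Y))) \<le> 1"
    using nc_triangle_mat_tuples[OF FX FY]
    by (auto simp: nc_closed_ball_def dest: mat_tuples_unique)
  have "norm (nc_eval P m (F Y) v i) \<le> opnorm_pow n (nc_eval P n (F X)) * norm (v i) + (1 / c) * s"
    if v: "norm_pow m v \<le> 1" and s: "0 \<le> s" "1 - s\<^sup>2 \<le> (norm_pow m (nc_eval P m (F Y) v))\<^sup>2" for v s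
  proof -
    let ?b = "nc_eval P m (\<lambda>j. complex_of_real c \<cdot>\<^sub>m B j) v"
    have "(norm_pow n ?b)\<^sup>2 \<le> s\<^sup>2"
      using nc_triangle_contraction[OF P FX FY T v] s(2) by simp
    then have "norm_pow n ?b \<le> s" using s(1) by (rule power2_le_imp_le)
    then have "norm (?b 0) \<le> s" using norm_le_norm_pow[of 0 n ?b] n by simp
    moreover have "?b 0 = complex_of_real c *\<^sub>C nc_eval P m B v 0"
      using n carr[OF FX FY] by (intro nc_eval_smult[where n = n]) (auto simp: B_def)
    ultimately have "c * norm (nc_eval P m B v 0) \<le> s" using c by (simp add: norm_scaleC)
    then have "norm (nc_eval P m B v 0) \<le> (1 / c) * s" using c by (simp add: field_simps)
    then have "norm ((\<Sum>j\<in>UNIV. (F X j $$ (0, 0)) *\<^sub>C P j (v i)) - nc_eval P m (F Y) v i) \<le> (1 / c) * s"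
      unfolding B_def nc_eval_commutator[OF FX FY n i] .
    then show ?thesis
      using nc_eval_corner[OF P n, where X = "F X" and x = "v i"]
        norm_triangle_ineq2[of "nc_eval P m (F Y) v i" "\<Sum>j\<in>UNIV. (F X j $$ (0, 0)) *\<^sub>C P j (v i)"]
      by (simp add: norm_minus_commute)
  qed
  then show ?thesis using c by (intro exI[of _ "1 / c"]) auto
qed

text \<open>
  The coordinate estimates add up, by the triangle inequality for the Euclidean norm over the
  coordinates, to a bound that excludes norms close to \<open>1\<close>.
\<close>

lemma strict_contraction_propagates:
  assumes Q: "\<forall>j. bounded_clinear (Q j)" and P: "\<forall>j. bounded_clinear (P j)"
    and V: "nc_subvariety Q V" and F: "nc_function V F" and FV: "F ` V \<subseteq> nc_closed_ball P"
    and X: "X \<in> V" "F X \<in> nc_ball P" and Y: "Y \<in> V"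
  shows "F Y \<in> nc_ball P"
proof -
  obtain n where n: "1 \<le> n" "X \<in> mat_tuples n"
    using F X(1) by (auto simp: nc_function_def nc_set_def nc_univ_def)
  obtain m where m: "1 \<le> m" "Y \<in> mat_tuples m"
    using F Y by (auto simp: nc_function_def nc_set_def nc_univ_def)
  have FX: "F X \<in> mat_tuples n" and FY: "F Y \<in> mat_tuples m"
    using F X Y n m by (auto simp: nc_function_def)
  define a where "a = opnorm_pow n (nc_eval P n (F X))"
  have a: "0 \<le> a" "a < 1"
    using X(2) FX opnorm_pow_nonneg[OF P] by (auto simp: a_def nc_ball_def dest: mat_tuples_unique)
  let ?D = "nc_eval P m (F Y)"
  obtain C where C: "\<And>i. i < m \<Longrightarrow> 0 \<le> C i"
    and est: "\<And>i v s. i < m \<Longrightarrow> norm_pow m v \<le> 1 \<Longrightarrow> 0 \<le> s \<Longrightarrow> 1 - s\<^sup>2 \<le> (norm_pow m (?D v))\<^sup>2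
      \<Longrightarrow> norm (?D v i) \<le> a * norm (v i) + C i * s"
  proof -
    have "\<forall>i\<in>{..<m}. \<exists>C\<ge>0. \<forall>v s. norm_pow m v \<le> 1 \<longrightarrow> 0 \<le> s \<longrightarrow> 1 - s\<^sup>2 \<le> (norm_pow m (?D v))\<^sup>2
      \<longrightarrow> norm (?D v i) \<le> a * norm (v i) + C * s"
      unfolding a_def using coordinate_estimate[OF Q P V F FV X(1) n(2) Y m(2) n(1)] by blast
    from bchoice[OF this] show ?thesis using that by (metis lessThan_iff)
  qed
  define K where "K = (\<Sum>i<m. C i)"
  have K: "0 \<le> K" unfolding K_def using C by (intro sum_nonneg) auto
  have total: "norm_pow m (?D v) \<le> a + K * s"
    if v: "norm_pow m v \<le> 1" and s: "0 \<le> s" "1 - s\<^sup>2 \<le> (norm_pow m (?D v))\<^sup>2" for v s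
  proof -
    have "norm_pow m (?D v) \<le> L2_set (\<lambda>i. a * norm (v i) + C i * s) {..<m}"
      unfolding norm_pow_def by (rule L2_set_mono) (use est[OF _ v s] in auto)
    also have "\<dots> \<le> L2_set (\<lambda>i. a * norm (v i)) {..<m} + L2_set (\<lambda>i. C i * s) {..<m}"
      by (rule L2_set_triangle_ineq)
    also have "L2_set (\<lambda>i. a * norm (v i)) {..<m} = a * norm_pow m v"
      using a by (simp add: norm_pow_def L2_set_right_distrib)
    also have "a * norm_pow m v \<le> a" using a v by (simp add: mult_left_le)
    also have "L2_set (\<lambda>i. C i * s) {..<m} \<le> K * s"
      using C s(1) unfolding K_def sum_distrib_right by (intro L2_set_le_sum) auto
    finally show ?thesis by simp
  qed
  \<comment> \<open>Chosen so that \<open>a + K * s = 1 - s\<close>, which is less than \<open>1 - s\<^sup>2 / 2\<close>.\<close>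
  define s where "s = (1 - a) / (K + 1)"
  have "(K + 1) * s = 1 - a" using K by (simp add: s_def)
  then have s: "0 < s" "s \<le> 1" "K * s + s = 1 - a"
    using a K by (simp_all add: distrib_right) (simp_all add: s_def)
  have "norm_pow m (?D v) \<le> 1 - s\<^sup>2 / 2" if v: "norm_pow m v \<le> 1" for v
  proof (rule ccontr)
    assume *: "\<not> ?thesis"
    have s2: "s\<^sup>2 \<le> s" using s by (simp add: power2_eq_square mult_left_le)
    have "1 - s\<^sup>2 \<le> (1 - s\<^sup>2 / 2)\<^sup>2" using s(1) by (simp add: power2_eq_square algebra_simps)
    also have "\<dots> \<le> (norm_pow m (?D v))\<^sup>2" using * s s2 by (intro power_mono) auto
    finally have "norm_pow m (?D v) \<le> a + K * s" using total v s by simp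
    then show False using * s s2 by linarith
  qed
  then have "opnorm_pow m ?D \<le> 1 - s\<^sup>2 / 2"
    unfolding opnorm_pow_def using norm_pow_zero[of m]
    by (intro cSUP_least) (auto intro: exI[of _ "\<lambda>i. 0"])
  also have "\<dots> < 1" using s by simp
  finally show ?thesis using FY m(1) by (auto simp: nc_ball_def)
qed

lemma nc_closed_ball_eq: "nc_closed_ball P = nc_ball P \<union> nc_sphere P"
  unfolding nc_closed_ball_def nc_ball_def nc_sphere_def by (auto simp: less_le)

lemma nc_ball_sphere_disjoint: "nc_ball P \<inter> nc_sphere P = {}"
  by (auto simp: nc_ball_def nc_sphere_def dest: mat_tuples_unique)

theorem theorem4p9:
  fixes Q :: "'d1::finite \<Rightarrow> 'r1::complex_hilbert \<Rightarrow> 's1::complex_hilbert"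
    and P :: "'d2::finite \<Rightarrow> 'r2::complex_hilbert \<Rightarrow> 's2::complex_hilbert"
    and V :: "'d1 tuple set"
    and F :: "'d1 tuple \<Rightarrow> 'd2 tuple"
  assumes "\<And>j. bounded_clinear (Q j)" and "clin_independent Q"
    and "\<And>j. bounded_clinear (P j)" and "clin_independent P"
    and "nc_subvariety Q V"
    and "nc_function V F" and "F ` V \<subseteq> nc_closed_ball P"
  shows "((\<exists>X0\<in>V. F X0 \<in> nc_ball P) \<longrightarrow> F ` V \<subseteq> nc_ball P) \<and>
         ((\<exists>X0\<in>V. F X0 \<in> nc_sphere P) \<longrightarrow> F ` V \<subseteq> nc_sphere P)"
proof -
  have propagate: "F Y \<in> nc_ball P" if "X \<in> V" "F X \<in> nc_ball P" "Y \<in> V" for X Y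
    using strict_contraction_propagates[OF _ _ assms(5,6,7) that] assms(1,3) by blast
  show ?thesis
  proof (intro conjI impI)
    assume "\<exists>X0\<in>V. F X0 \<in> nc_ball P"
    then show "F ` V \<subseteq> nc_ball P" using propagate by blast
  next
    assume "\<exists>X0\<in>V. F X0 \<in> nc_sphere P"
    then show "F ` V \<subseteq> nc_sphere P"
      using propagate assms(7) nc_ball_sphere_disjoint[of P] unfolding nc_closed_ball_eq by blast
  qed
qed

end
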